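(* Let $R$ be an associative ring, let $n\ge 1$ be an integer, and let $I$ be a Lie nilpotent one-sided (left or right) ideal of $R$. If $I\subseteq R_n$ and the Lie nilpotency class of $I$ is less than $n$, then $I$ is contained in an (associative) nilpotent two-sided ideal of $R$.
   Context: Associative rings are not assumed to have an identity element, so one-sided ideals are subrings. For an associative ring $A$, $A^{(-)}$ denotes its adjoint Lie ring: the additive group of $A$ with bracket $[a,b]=ab-ba$. For additive subgroups $X,Y$, $[X,Y]$ denotes the additive subgroup generated by all $[x,y]$, $x\in X$, $y\in Y$. The lower central series of $A^{(-)}$ is $A^{(-)}_1=A$, $A^{(-)}_{k+1}=[A^{(-)}_k,A]$. The ring $A$ is Lie nilpotent if $A^{(-)}_{k+1}=0$ for some $k\ge 0$, and its Lie nilpotency class is the least such $k$. A one-sided ideal is called Lie nilpotent if it is so as a ring in its own right. For a ring $R$ and $n\ge 1$, $R_n=R^{(-)}_n+R^{(-)}_n\cdot R=R^{(-)}_n+R\cdot R^{(-)}_n$ is the two-sided ideal of the associative ring $R$ generated by all commutators $[\ldots[[r_1,r_2],r_3],\ldots,r_n]$ with $r_1,\ldots,r_n\in R$. An ideal $S$ is nilpotent if $S^k=0$ for some $k\ge 1$ (associative product). *)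

theory Defs
  imports Main "HOL.Hull" "HOL-Library.Set_Algebras" "HOL-Computational_Algebra.Group_Closure"
begin

text \<open>
  The class \<^class>\<open>ring\<close> does not provide an identity element, so the ambient associative
  ring is a type of this class. Subrings and one-sided ideals are subsets of that type.
  Sums and products of sets are the elementwise ones of Set-Algebras; the products and brackets
  of additive subgroups that the theory needs are the additive subgroups generated by them.
\<close>

definition additive_subgroup :: "'a::ring set \<Rightarrow> bool" where
  "additive_subgroup I \<longleftrightarrow> 0 \<in> I \<and> (\<forall>x\<in>I. \<forall>y\<in>I. x - y \<in> I)"

definition left_ideal :: "'a::ring set \<Rightarrow> bool" where
  "left_ideal I \<longleftrightarrow> additive_subgroup I \<and> (\<forall>r. \<forall>x\<in>I. r * x \<in> I)"

definition right_ideal :: "'a::ring set \<Rightarrow> bool" where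
  "right_ideal I \<longleftrightarrow> additive_subgroup I \<and> (\<forall>r. \<forall>x\<in>I. x * r \<in> I)"

definition two_sided_ideal :: "'a::ring set \<Rightarrow> bool" where
  "two_sided_ideal I \<longleftrightarrow> left_ideal I \<and> right_ideal I"

definition subgroup_mult :: "'a::ring set \<Rightarrow> 'a set \<Rightarrow> 'a set" where
  "subgroup_mult X Y = group_closure (X * Y)"

definition commutator :: "'a::ring \<Rightarrow> 'a \<Rightarrow> 'a" where
  "commutator a b = a * b - b * a"

definition subgroup_bracket :: "'a::ring set \<Rightarrow> 'a set \<Rightarrow> 'a set" where
  "subgroup_bracket X Y = group_closure {commutator x y | x y. x \<in> X \<and> y \<in> Y}"

text \<open>
  The series starts at index 1; the value at 0 is a dummy. The set \<open>A\<close> is meant to be a subring,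
  and only elements of \<open>A\<close> enter the brackets, so this is the series of \<open>A\<close> as a ring in its own
  right.
\<close>

fun lie_lower_central :: "'a::ring set \<Rightarrow> nat \<Rightarrow> 'a set" where
  "lie_lower_central A 0 = A"
| "lie_lower_central A (Suc 0) = A"
| "lie_lower_central A (Suc (Suc k)) = subgroup_bracket (lie_lower_central A (Suc k)) A"

definition lie_nilpotent :: "'a::ring set \<Rightarrow> bool" where
  "lie_nilpotent A \<longleftrightarrow> (\<exists>k. lie_lower_central A (k + 1) = {0})"

text \<open>Only meaningful under \<^const>\<open>lie_nilpotent\<close>.\<close>

definition lie_nilpotency_class :: "'a::ring set \<Rightarrow> nat" where
  "lie_nilpotency_class A = (LEAST k. lie_lower_central A (k + 1) = {0})"

text \<open>For a ring \<open>R\<close> and \<open>n \<ge> 1\<close> this is the ideal \<open>R\<^sub>n\<close> of \<open>R\<close>.\<close>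

definition lie_lower_central_ideal :: "'a::ring set \<Rightarrow> nat \<Rightarrow> 'a set" where
  "lie_lower_central_ideal R n =
     lie_lower_central R n + subgroup_mult (lie_lower_central R n) R"

text \<open>Powers also start at exponent 1, as there may be no identity; the value at 0 is a dummy.\<close>

fun ideal_power :: "'a::ring set \<Rightarrow> nat \<Rightarrow> 'a set" where
  "ideal_power S 0 = UNIV"
| "ideal_power S (Suc 0) = S"
| "ideal_power S (Suc (Suc k)) = subgroup_mult (ideal_power S (Suc k)) S"

definition assoc_nilpotent :: "'a::ring set \<Rightarrow> bool" where
  "assoc_nilpotent S \<longleftrightarrow> (\<exists>k\<ge>1. ideal_power S k = {0})"

text \<open>
  The ideal \<open>R\<^sub>n\<close> agrees with its left-handed description and with the two-sided ideal generated
  by the left-normed commutators of length \<open>n\<close>.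
\<close>

lemma group_closure_least:
  assumes "S \<subseteq> T" "additive_subgroup T"
  shows "group_closure S \<subseteq> T"
proof
  fix x assume "x \<in> group_closure S"
  then show "x \<in> T"
    by induction (use assms in \<open>auto simp: additive_subgroup_def\<close>)
qed

lemma additive_subgroup_closure: "additive_subgroup (group_closure S)"
  by (auto simp: additive_subgroup_def intro: group_closure.diff)

lemma additive_subgroup_add:
  assumes "additive_subgroup T" "x \<in> T" "y \<in> T"
  shows "x + y \<in> T"
proof -
  have "x - (0 - y) \<in> T"
    using assms unfolding additive_subgroup_def by blast
  then show ?thesis by simp
qed

lemma additive_subgroup_plus:
  assumes "additive_subgroup S" "additive_subgroup T"
  shows "additive_subgroup (S + T)"
  unfolding additive_subgroup_def
proof (intro conjI ballI)
  have "0 + 0 \<in> S + T"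
    using assms by (intro set_plus_intro) (auto simp: additive_subgroup_def)
  then show "0 \<in> S + T" by simp
next
  fix x y assume "x \<in> S + T" "y \<in> S + T"
  then obtain a b c d where "x = a + b" "y = c + d" "a \<in> S" "c \<in> S" "b \<in> T" "d \<in> T"
    by (auto simp: set_plus_def)
  moreover from this have "(a - c) + (b - d) \<in> S + T"
    using assms by (intro set_plus_intro) (auto simp: additive_subgroup_def)
  ultimately show "x - y \<in> S + T"
    by (simp add: algebra_simps)
qed

lemma additive_subgroup_lie_lower_central:
  "additive_subgroup (lie_lower_central (UNIV :: 'a::ring set) n)"
proof -
  have "additive_subgroup (UNIV :: 'a set)"
    by (simp add: additive_subgroup_def)
  then show ?thesis
    by (cases "(UNIV :: 'a set, n)" rule: lie_lower_central.cases)
      (auto simp: subgroup_bracket_def additive_subgroup_closure)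
qed

lemma lie_lower_central_commutator:
  assumes "x \<in> lie_lower_central (UNIV :: 'a::ring set) n"
  shows "commutator x r \<in> lie_lower_central UNIV n"
  using assms
proof (induction n arbitrary: x r)
  case 0
  then show ?case by simp
next
  case (Suc n)
  show ?case
  proof (cases n)
    case 0
    then show ?thesis by simp
  next
    case (Suc m)
    have "lie_lower_central (UNIV :: 'a set) (Suc n) \<subseteq> lie_lower_central UNIV n"
      unfolding Suc lie_lower_central.simps subgroup_bracket_def
      by (rule group_closure_least)
        (use Suc.IH Suc in \<open>auto simp: additive_subgroup_lie_lower_central\<close>)
    then have "x \<in> lie_lower_central UNIV n"
      using Suc.prems by blast
    then show ?thesis
      unfolding Suc lie_lower_central.simps subgroup_bracket_def
      by (blast intro: group_closure.base)
  qed
qed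

lemma two_sided_ideal_lie_lower_central_ideal:
  "two_sided_ideal (lie_lower_central_ideal (UNIV :: 'a::ring set) n)"
proof -
  let ?L = "lie_lower_central (UNIV :: 'a set) n"
  let ?M = "group_closure (?L * UNIV)"
  let ?T = "?L + ?M"
  have T: "additive_subgroup ?T"
    by (intro additive_subgroup_plus additive_subgroup_lie_lower_central additive_subgroup_closure)
  have M_T: "x \<in> ?T" if "x \<in> ?M" for x
  proof -
    have "0 + x \<in> ?T"
      using that additive_subgroup_lie_lower_central
      by (intro set_plus_intro) (auto simp: additive_subgroup_def)
    then show ?thesis by simp
  qed
  have L_T: "x \<in> ?T" if "x \<in> ?L" for x
  proof -
    have "x + 0 \<in> ?T"
      using that by (intro set_plus_intro) auto
    then show ?thesis by simp
  qed
  have LU: "x * r \<in> ?M" if "x \<in> ?L" for x r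
    using that by (auto intro!: group_closure.base set_times_intro)
  have rL: "r * x \<in> ?T" if "x \<in> ?L" for x r
  proof -
    have "r * x = x * r - commutator x r"
      by (simp add: commutator_def)
    then show ?thesis
      using T LU[OF that] M_T L_T lie_lower_central_commutator[OF that]
      by (auto simp: additive_subgroup_def)
  qed
  have Mr: "x * r \<in> ?M" if "x \<in> ?M" for x r
    using that
  proof induction
    case (base s)
    then show ?case
      using LU by (auto simp: set_times_def mult.assoc)
  next
    case (diff s t)
    then show ?case
      by (auto simp: left_diff_distrib intro: group_closure.diff)
  qed
  have rM: "r * x \<in> ?T" if "x \<in> ?M" for x r
    using that
  proof induction
    case (base s)
    show ?case
    proof (cases "s = 0")
      case True
      then show ?thesis using T by (simp add: additive_subgroup_def)
    next
      case False
      then obtain a b where ab: "s = a * b" "a \<in> ?L"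
        using base by (auto simp: set_times_def)
      have "r * s = a * (r * b) - commutator a r * b"
        using ab by (simp add: commutator_def algebra_simps)
      also have "\<dots> \<in> ?M"
        using LU ab lie_lower_central_commutator by (blast intro: group_closure.diff)
      finally show ?thesis by (rule M_T)
    qed
  next
    case (diff s t)
    then show ?case
      using T by (auto simp: right_diff_distrib additive_subgroup_def)
  qed
  have "r * x \<in> ?T" "x * r \<in> ?T" if x: "x \<in> ?T" for x r
  proof -
    obtain a b where "x = a + b" "a \<in> ?L" "b \<in> ?M"
      using x by (auto simp: set_plus_def)
    then show "r * x \<in> ?T" "x * r \<in> ?T"
      using additive_subgroup_add[OF T] rL rM M_T LU Mr
      by (auto simp: distrib_left distrib_right)
  qed
  then show ?thesis
    using T
    unfolding two_sided_ideal_def left_ideal_def right_ideal_def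
      lie_lower_central_ideal_def subgroup_mult_def by blast
qed

lemma lie_lower_central_ideal_eq_left:
  "lie_lower_central_ideal (UNIV :: 'a::ring set) n =
     lie_lower_central UNIV n + subgroup_mult UNIV (lie_lower_central UNIV n)"
proof -
  let ?L = "lie_lower_central (UNIV :: 'a set) n"
  let ?M = "group_closure (?L * UNIV)" and ?M' = "group_closure (UNIV * ?L)"
  have sub: "?L + group_closure A \<subseteq> ?L + group_closure B"
    if "\<And>x. x \<in> A \<Longrightarrow> x \<in> ?L + group_closure B" for A B
  proof
    have T: "additive_subgroup (?L + group_closure B)"
      by (intro additive_subgroup_plus additive_subgroup_lie_lower_central additive_subgroup_closure)
    fix x assume "x \<in> ?L + group_closure A"
    then obtain a b where ab: "x = a + b" "a \<in> ?L" "b \<in> group_closure A"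
      by (auto simp: set_plus_def)
    have "b \<in> ?L + group_closure B"
      using group_closure_least[OF _ T, of A] that ab by blast
    moreover have "a + 0 \<in> ?L + group_closure B"
      using ab by (intro set_plus_intro) auto
    ultimately show "x \<in> ?L + group_closure B"
      using additive_subgroup_add[OF T] ab by auto
  qed
  have neg: "- commutator a b \<in> ?L" if "a \<in> ?L" for a b
  proof -
    have "0 - commutator a b \<in> ?L"
      using additive_subgroup_lie_lower_central[of n] lie_lower_central_commutator[OF that]
      unfolding additive_subgroup_def by blast
    then show ?thesis by simp
  qed
  have "?L + ?M \<subseteq> ?L + ?M'"
  proof (rule sub)
    fix x assume "x \<in> ?L * UNIV"
    then obtain a b where "x = commutator a b + b * a" "a \<in> ?L"
      by (auto simp: set_times_def commutator_def)
    then show "x \<in> ?L + ?M'"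
      by (auto intro!: set_plus_intro group_closure.base lie_lower_central_commutator)
  qed
  moreover have "?L + ?M' \<subseteq> ?L + ?M"
  proof (rule sub)
    fix x assume "x \<in> UNIV * ?L"
    then obtain a b where "x = - commutator a b + a * b" "a \<in> ?L"
      by (auto simp: set_times_def commutator_def)
    moreover from this have "a * b \<in> ?M"
      by (auto intro!: group_closure.base set_times_intro)
    ultimately show "x \<in> ?L + ?M"
      using neg by (blast intro: set_plus_intro)
  qed
  ultimately show ?thesis
    unfolding lie_lower_central_ideal_def subgroup_mult_def by blast
qed

lemma foldl_commutator_in_lie_lower_central:
  "foldl commutator r rs \<in> lie_lower_central (UNIV :: 'a::ring set) (Suc (length rs))"
proof (induction rs rule: rev_induct)
  case Nil
  then show ?case by simp
next
  case (snoc x xs)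
  then show ?case
    by (auto simp: subgroup_bracket_def intro!: group_closure.base)
qed

lemma lie_lower_central_subset_ideal:
  assumes "two_sided_ideal J" and "\<And>r rs. length rs = m \<Longrightarrow> foldl commutator r rs \<in> J"
  shows "lie_lower_central (UNIV :: 'a::ring set) (Suc m) \<subseteq> J"
proof -
  have span: "lie_lower_central (UNIV :: 'a set) (Suc m)
      \<subseteq> group_closure {foldl commutator r rs | r rs. length rs = m}"
  proof (induction m)
    case 0
    then show ?case by (auto intro: group_closure.base)
  next
    case (Suc m)
    let ?C = "\<lambda>m. {foldl commutator r rs :: 'a | r rs. length rs = m}"
    have "commutator x y \<in> group_closure (?C (Suc m))" if "x \<in> group_closure (?C m)" for x y
      using that
    proof induction
      case (base s)
      show ?case
      proof (cases "s = 0")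
        case True
        then show ?thesis by (simp add: commutator_def)
      next
        case False
        then obtain r rs where "s = foldl commutator r rs" "length rs = m"
          using base by blast
        then have "commutator s y = foldl commutator r (rs @ [y])" "length (rs @ [y]) = Suc m"
          by simp_all
        then show ?thesis by (blast intro: group_closure.base)
      qed
    next
      case (diff s t)
      have "commutator (s - t) y = commutator s y - commutator t y"
        by (simp add: commutator_def algebra_simps)
      then show ?case using diff by (auto intro: group_closure.diff)
    qed
    then show ?case
      unfolding lie_lower_central.simps subgroup_bracket_def
      using Suc by (intro group_closure_least additive_subgroup_closure) blast
  qed
  have "group_closure {foldl commutator r rs | r rs. length rs = m} \<subseteq> J"
    using assms by (intro group_closure_least)
      (auto simp: two_sided_ideal_def left_ideal_def)
  with span show ?thesis by blast
qed

lemma lie_lower_central_ideal_eq_hull: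
  assumes "n \<ge> 1"
  shows "lie_lower_central_ideal (UNIV :: 'a::ring set) n =
    two_sided_ideal hull {foldl commutator r rs | r rs. length rs = n - 1}"
proof (rule hull_unique[symmetric])
  obtain m where m: "n = Suc m"
    using assms by (cases n) auto
  let ?L = "lie_lower_central (UNIV :: 'a set) n"
  have "x \<in> lie_lower_central_ideal UNIV n" if "x \<in> ?L" for x
  proof -
    have "x + 0 \<in> lie_lower_central_ideal UNIV n"
      using that unfolding lie_lower_central_ideal_def subgroup_mult_def
      by (intro set_plus_intro) auto
    then show ?thesis by simp
  qed
  then show "{foldl commutator r rs | r rs. length rs = n - 1}
      \<subseteq> lie_lower_central_ideal (UNIV :: 'a set) n"
    using foldl_commutator_in_lie_lower_central m by fastforce
  show "two_sided_ideal (lie_lower_central_ideal (UNIV :: 'a set) n)"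
    by (rule two_sided_ideal_lie_lower_central_ideal)
next
  fix J :: "'a set"
  assume C: "{foldl commutator r rs | r rs. length rs = n - 1} \<subseteq> J" and J: "two_sided_ideal J"
  let ?L = "lie_lower_central (UNIV :: 'a set) n"
  have L: "?L \<subseteq> J"
    using lie_lower_central_subset_ideal[OF J, of "n - 1"] C assms by auto
  have sJ: "additive_subgroup J" and rJ: "\<And>x r. x \<in> J \<Longrightarrow> x * r \<in> J"
    using J by (auto simp: two_sided_ideal_def left_ideal_def right_ideal_def)
  have "group_closure (?L * UNIV) \<subseteq> J"
    using L rJ by (intro group_closure_least sJ) (auto simp: set_times_def)
  with L show "lie_lower_central_ideal UNIV n \<subseteq> J"
    unfolding lie_lower_central_ideal_def subgroup_mult_def
    by (auto simp: set_plus_def intro!: additive_subgroup_add[OF sJ])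
qed

end

theory Submission
  imports Defs
begin

text \<open>
  Let \<open>J\<close> be a nilpotent ideal that contains the term \<open>k + 1\<close> of the lower central series of
  the left ideal \<open>I\<close>, and let \<open>Z\<close> be the set of elements of \<open>I\<close> that are central in \<open>I\<close>
  modulo \<open>J\<close>. For \<open>c\<^sub>1, \<dots>, c\<^sub>n \<in> Z\<close> the commutators \<open>[r\<^sub>1 c\<^sub>1, \<dots>, r\<^sub>n c\<^sub>n]\<close> and
  \<open>[r\<^sub>1, \<dots>, r\<^sub>n] c\<^sub>1 \<dots> c\<^sub>n\<close> agree modulo \<open>J\<close>, and the former lies in \<open>J\<close> because
  \<open>k < n\<close>. As \<open>Z \<subseteq> I \<subseteq> R\<^sub>n\<close>, all products of \<open>n + 1\<close> elements of \<open>Z\<close> lie in \<open>J\<close>, so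
  the ideal generated by \<open>J\<close> and \<open>Z\<close> is nilpotent. It contains the term \<open>k\<close> of the lower
  central series of \<open>I\<close>, and induction on \<open>k\<close> yields a nilpotent ideal containing \<open>I\<close>.
\<close>

section \<open>Ideals and powers of ideals\<close>

lemma additive_subgroup_zero: "additive_subgroup T \<Longrightarrow> 0 \<in> T"
  and additive_subgroup_diff: "additive_subgroup T \<Longrightarrow> x \<in> T \<Longrightarrow> y \<in> T \<Longrightarrow> x - y \<in> T"
  by (auto simp: additive_subgroup_def)

lemma two_sided_ideal_iff:
  "two_sided_ideal J \<longleftrightarrow> additive_subgroup J \<and> (\<forall>r. \<forall>x\<in>J. r * x \<in> J \<and> x * r \<in> J)"
  by (auto simp: two_sided_ideal_def left_ideal_def right_ideal_def)

lemma two_sided_ideal_hull: "two_sided_ideal (two_sided_ideal hull X)"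
  by (rule hull_in) (auto simp: two_sided_ideal_iff additive_subgroup_def)

lemma additive_subgroup_ideal_power:
  assumes "additive_subgroup S"
  shows "additive_subgroup (ideal_power S k)"
  using assms
  by (cases "(S, k)" rule: ideal_power.cases)
    (auto simp: subgroup_mult_def additive_subgroup_closure additive_subgroup_def[of UNIV])

text \<open>Adjacent factors from \<open>A\<close> are paired, each pair giving one factor from
  \<open>B\<close>. The induction starts at exponent 1 of \<open>B\<close>, where the recursion of
  \<open>ideal_power\<close> starts.\<close>

lemma ideal_power_double:
  assumes B: "two_sided_ideal B" and sq: "\<And>x y. x \<in> A \<Longrightarrow> y \<in> A \<Longrightarrow> x * y \<in> B"
  shows "ideal_power A (2 * Suc j) \<subseteq> ideal_power B (Suc j)"
proof (induction j)
  case 0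
  have "group_closure (A * A) \<subseteq> B"
    using B sq by (intro group_closure_least) (auto simp: two_sided_ideal_iff set_times_def)
  then show ?case
    by (simp add: subgroup_mult_def numeral_2_eq_2)
next
  case (Suc j)
  let ?P = "ideal_power B (Suc (Suc j))"
  have P: "additive_subgroup ?P"
    using B by (intro additive_subgroup_ideal_power) (simp add: two_sided_ideal_iff)
  \<comment> \<open>The two new factors are attached one at a time. The set on the right is an
    additive subgroup, so the odd power can be checked on the products that generate it.\<close>
  have "ideal_power A (Suc (2 * Suc j)) \<subseteq> {x. \<forall>a\<in>A. x * a \<in> ?P}"
  proof -
    have "x * a * b \<in> ?P" if "x \<in> ideal_power A (2 * Suc j)" "a \<in> A" "b \<in> A" for x a b
    proof -
      have "x * (a * b) \<in> ideal_power B (Suc j) * B"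
        using that Suc sq by (intro set_times_intro) auto
      then show ?thesis
        by (simp add: subgroup_mult_def mult.assoc group_closure.base)
    qed
    then have "group_closure (ideal_power A (2 * Suc j) * A) \<subseteq> {x. \<forall>a\<in>A. x * a \<in> ?P}"
      using P
      by (intro group_closure_least)
        (auto simp: set_times_def additive_subgroup_def left_diff_distrib simp del: ideal_power.simps)
    then show ?thesis
      by (simp add: subgroup_mult_def)
  qed
  then have "group_closure (ideal_power A (Suc (2 * Suc j)) * A) \<subseteq> ?P"
    by (intro group_closure_least P) (auto simp: set_times_def simp del: ideal_power.simps)
  then show ?case
    by (simp add: subgroup_mult_def)
qed

lemma assoc_nilpotent_square:
  assumes A: "two_sided_ideal A" and B: "two_sided_ideal B" "assoc_nilpotent B"
    and "\<And>x y. x \<in> A \<Longrightarrow> y \<in> A \<Longrightarrow> x * y \<in> B"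
  shows "assoc_nilpotent A"
proof -
  obtain j where "ideal_power B (Suc j) = {0}"
    using B(2) by (metis assoc_nilpotent_def Suc_pred less_eq_Suc_le One_nat_def)
  then have "ideal_power A (2 * Suc j) \<subseteq> {0}"
    using ideal_power_double[OF B(1) assms(4), of A j] by simp
  moreover have "0 \<in> ideal_power A (2 * Suc j)"
    using A by (intro additive_subgroup_zero additive_subgroup_ideal_power)
      (simp add: two_sided_ideal_iff)
  ultimately show ?thesis
    unfolding assoc_nilpotent_def by (intro exI[of _ "2 * Suc j"]) auto
qed

section \<open>Ideals of either side, modulo a two-sided ideal\<close>

text \<open>
  The locale treats left and right ideals at once: a right ideal is a left ideal with respect to
  the opposite multiplication.
\<close>

locale sided_ideal =
  fixes mul :: "'a::ring \<Rightarrow> 'a \<Rightarrow> 'a" (infixl "\<odot>" 70)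
    and I J :: "'a set"
  assumes mul_cases: "mul = (*) \<or> mul = (\<lambda>x y. y * x)"
    and I_subgroup: "additive_subgroup I"
    and mul_I: "x \<in> I \<Longrightarrow> r \<odot> x \<in> I"
    and J_ideal: "two_sided_ideal J"
begin

lemma mul_assoc: "(x \<odot> y) \<odot> z = x \<odot> (y \<odot> z)"
  and mul_diff: "x \<odot> (y - z) = x \<odot> y - x \<odot> z"
  and diff_mul: "(y - z) \<odot> x = y \<odot> x - z \<odot> x"
  and mul_zero: "x \<odot> 0 = 0" "0 \<odot> x = 0"
  using mul_cases by (auto simp: algebra_simps)

lemma ideal_mul:
  assumes "two_sided_ideal K" "x \<in> K"
  shows "r \<odot> x \<in> K" "x \<odot> r \<in> K"
  using mul_cases assms by (auto simp: two_sided_ideal_iff)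

text \<open>The commutator of \<open>mul\<close>. For the opposite multiplication it is the negative
  of \<open>commutator\<close>, and additive subgroups do not see the sign.\<close>

definition br :: "'a \<Rightarrow> 'a \<Rightarrow> 'a" where
  "br x y = x \<odot> y - y \<odot> x"

lemma br_cases: "(\<forall>x y. commutator x y = br x y) \<or> (\<forall>x y. commutator x y = 0 - br x y)"
  using mul_cases by (auto simp: br_def commutator_def)

lemma br_mem_iff:
  assumes "additive_subgroup K"
  shows "br x y \<in> K \<longleftrightarrow> commutator x y \<in> K"
proof -
  have "0 - z \<in> K \<longleftrightarrow> z \<in> K" for z
    using assms by (metis additive_subgroup_def diff_0 minus_minus)
  then show ?thesis
    using br_cases by metis
qed

lemmas J_subgroup = J_ideal[unfolded two_sided_ideal_iff, THEN conjunct1]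
lemmas J_add = additive_subgroup_add[OF J_subgroup]
lemmas J_mul = ideal_mul[OF J_ideal]

section \<open>Products of elements central modulo \<open>J\<close>\<close>

definition Z :: "'a set" where
  "Z = {c \<in> I. \<forall>x\<in>I. br c x \<in> J}"

text \<open>Index \<open>i\<close> stands for \<open>i + 1\<close> factors, since without an
  identity there is no empty product. No additive closure is taken, as the sets tested against these
  products are subgroups or ideals already.\<close>

primrec Zpow :: "nat \<Rightarrow> 'a set" where
  "Zpow 0 = Z"
| "Zpow (Suc i) = {c \<odot> w | c w. c \<in> Z \<and> w \<in> Zpow i}"

lemma Zpow_subset: "Zpow i \<subseteq> I"
  by (induction i) (auto simp: Z_def mul_I)

text \<open>Bracketing with \<open>x\<close> is a derivation of \<open>mul\<close>, so centrality
  modulo \<open>J\<close> passes to products.\<close>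

lemma Zpow_central:
  assumes "w \<in> Zpow i" "x \<in> I"
  shows "br w x \<in> J" "br x w \<in> J"
proof -
  show "br w x \<in> J"
    using assms(1)
  proof (induction i arbitrary: w)
    case 0
    then show ?case using assms(2) by (simp add: Z_def)
  next
    case (Suc i)
    then obtain c v where w: "w = c \<odot> v" "c \<in> Z" "v \<in> Zpow i"
      by auto
    have "br w x = c \<odot> br v x + br c x \<odot> v"
      by (simp add: w(1) br_def mul_diff diff_mul mul_assoc)
    then show ?case
      using Suc.IH[OF w(3)] w(2) assms(2) by (simp add: Z_def J_add J_mul)
  qed
  then have "0 - br w x \<in> J"
    using J_subgroup by (auto simp: additive_subgroup_def)
  then show "br x w \<in> J"
    by (simp add: br_def)
qed

section \<open>Commutators multiplied by central elements\<close>

lemma additive_subgroup_lower_central: "additive_subgroup (lie_lower_central I i)"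
  using I_subgroup
  by (cases "(I, i)" rule: lie_lower_central.cases)
    (auto simp: subgroup_bracket_def additive_subgroup_closure)

text \<open>Each of the \<open>i + 1\<close> entries of a left-normed commutator takes up one of the
  \<open>i + 1\<close> central factors. This moves the entry into \<open>I\<close>, at the cost of
  terms in \<open>J\<close>.\<close>

lemma lower_central_mul_Zpow:
  assumes "x \<in> lie_lower_central UNIV (Suc i)" "z \<in> Zpow i"
  shows "x \<odot> z \<in> lie_lower_central I (Suc i) + J"
  using assms
proof (induction i arbitrary: x z)
  case 0
  then have "x \<odot> z + 0 \<in> I + J"
    using Zpow_subset[of 0] J_subgroup
    by (intro set_plus_intro mul_I additive_subgroup_zero) auto
  then show ?case by simp
next
  case (Suc i)
  let ?T = "lie_lower_central I (Suc (Suc i)) + J"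
  have T: "additive_subgroup ?T"
    by (intro additive_subgroup_plus additive_subgroup_lower_central J_subgroup)
  have J_T: "j \<in> ?T" if "j \<in> J" for j
    using set_plus_intro[OF additive_subgroup_zero[OF additive_subgroup_lower_central[of "Suc (Suc i)"]] that]
    by simp
  let ?X = "{x. \<forall>z \<in> Zpow (Suc i). x \<odot> z \<in> ?T}"
  have X: "additive_subgroup ?X"
    using T by (auto simp: additive_subgroup_def mul_zero diff_mul)
  have "br y r \<odot> z \<in> ?T" if y: "y \<in> lie_lower_central UNIV (Suc i)" and "z \<in> Zpow (Suc i)" for y r z
  proof -
    \<comment> \<open>The first factor \<open>c\<close> goes to the new entry \<open>r\<close>; the
      others, collected in \<open>w\<close>, go to \<open>y\<close> by the induction
      hypothesis.\<close>
    obtain c w where z: "z = c \<odot> w" "c \<in> Z" "w \<in> Zpow i"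
      using \<open>z \<in> Zpow (Suc i)\<close> by auto
    have c: "c \<in> Zpow 0" using z by simp
    have cI: "c \<in> I" and wI: "w \<in> I"
      using c z Zpow_subset by blast+
    obtain a j where aj: "y \<odot> w = a + j" "a \<in> lie_lower_central I (Suc i)" "j \<in> J"
      using Suc.IH[OF y z(3)] by (auto simp: set_plus_def)
    have "commutator a (r \<odot> c) \<in> lie_lower_central I (Suc (Suc i))"
      unfolding lie_lower_central.simps subgroup_bracket_def
      using aj(2) mul_I[OF cI] by (intro group_closure.base) blast
    then have "br a (r \<odot> c) \<in> lie_lower_central I (Suc (Suc i))"
      using br_mem_iff[OF additive_subgroup_lower_central] by blast
    moreover have "br j (r \<odot> c) \<in> J"
      unfolding br_def using aj(3) by (intro additive_subgroup_diff J_subgroup J_mul)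
    ultimately have "br a (r \<odot> c) + br j (r \<odot> c) \<in> ?T"
      by (rule set_plus_intro)
    moreover have "br (y \<odot> w) (r \<odot> c) = br a (r \<odot> c) + br j (r \<odot> c)"
      unfolding aj(1) br_def using mul_cases by (auto simp: algebra_simps)
    ultimately have 1: "br (y \<odot> w) (r \<odot> c) \<in> ?T"
      by simp
    \<comment> \<open>Modulo \<open>J\<close>, \<open>w\<close> commutes with
      \<open>r \<odot> c\<close> and with \<open>c\<close>, and \<open>c\<close> commutes with
      \<open>y \<odot> w\<close>, because all these elements lie in \<open>I\<close>. Multiplied as
      in the identity below, the three brackets are the error terms between
      \<open>br (y \<odot> w) (r \<odot> c)\<close> and \<open>br y r \<odot> z\<close>.\<close>
    have "br (r \<odot> c) w \<in> J" "br c (y \<odot> w) \<in> J" "br w c \<in> J"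
      using Zpow_central[OF z(3)] Zpow_central[OF c] mul_I cI wI by blast+
    then have 2: "y \<odot> br (r \<odot> c) w \<in> ?T" "r \<odot> br c (y \<odot> w) \<in> ?T" "r \<odot> (y \<odot> br w c) \<in> ?T"
      by (blast intro: J_T J_mul)+
    have "br y r \<odot> z
        = br (y \<odot> w) (r \<odot> c) + y \<odot> br (r \<odot> c) w + r \<odot> br c (y \<odot> w) + r \<odot> (y \<odot> br w c)"
      by (simp add: z(1) br_def mul_diff diff_mul mul_assoc)
    then show ?thesis
      using 1 2 additive_subgroup_add[OF T] by simp
  qed
  then have "commutator y r \<in> ?X" if "y \<in> lie_lower_central UNIV (Suc i)" for y r
    using that br_mem_iff[OF X, of y r] by blast
  then have "lie_lower_central UNIV (Suc (Suc i)) \<subseteq> ?X"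
    unfolding lie_lower_central.simps(3)[of UNIV] subgroup_bracket_def
    by (intro group_closure_least X) blast
  then show ?case
    using Suc.prems by blast
qed

text \<open>The ideal is spanned by the commutators together with their multiples from either side,
  so the side can be chosen to match \<open>mul\<close>. The intended \<open>P\<close> consists of
  elements that given factors carry into \<open>J\<close>.\<close>

lemma lie_lower_central_ideal_least:
  assumes P: "additive_subgroup P" "lie_lower_central UNIV n \<subseteq> P"
    and mul: "\<And>r x. x \<in> lie_lower_central UNIV n \<Longrightarrow> r \<odot> x \<in> P"
  shows "lie_lower_central_ideal UNIV n \<subseteq> P"
proof -
  have sum: "lie_lower_central UNIV n + group_closure X \<subseteq> P" if "X \<subseteq> P" for X
    using P(2) group_closure_least[OF that P(1)]
    by (auto simp: set_plus_def intro!: additive_subgroup_add[OF P(1)])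
  from mul_cases show ?thesis
  proof
    assume "mul = (*)"
    then show ?thesis
      unfolding lie_lower_central_ideal_eq_left subgroup_mult_def
      using mul by (intro sum) (auto simp: set_times_def)
  next
    assume "mul = (\<lambda>x y. y * x)"
    then show ?thesis
      unfolding lie_lower_central_ideal_def subgroup_mult_def
      using mul by (intro sum) (auto simp: set_times_def)
  qed
qed

text \<open>Write \<open>n = Suc i\<close>. The last \<open>n\<close> factors form an element of
  \<open>Zpow i\<close>, which carries \<open>R_n\<close> into \<open>J\<close>; the first factor is
  in \<open>R_n\<close> because \<open>Z\<close> lies in \<open>I\<close>.\<close>

lemma Zpow_subset_J:
  assumes "I \<subseteq> lie_lower_central_ideal UNIV (Suc i)" "lie_lower_central I (Suc i) \<subseteq> J"
  shows "Zpow (Suc i) \<subseteq> J"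
proof -
  have L: "x \<odot> w \<in> J" if "x \<in> lie_lower_central UNIV (Suc i)" "w \<in> Zpow i" for x w
    using lower_central_mul_Zpow[OF that] assms(2) by (auto simp: set_plus_def intro!: J_add)
  have "lie_lower_central_ideal UNIV (Suc i) \<subseteq> {x. \<forall>w \<in> Zpow i. x \<odot> w \<in> J}"
    using J_subgroup L
    by (intro lie_lower_central_ideal_least)
      (auto simp: additive_subgroup_def mul_zero diff_mul mul_assoc J_mul)
  then show ?thesis
    using assms(1) by (auto simp: Z_def)
qed

section \<open>Nilpotency of the ideal generated by \<open>J\<close> and \<open>Z\<close>\<close>

text \<open>These ideals stand in for the powers of \<open>Zideal 0\<close> modulo \<open>J\<close>:
  multiplication by \<open>Zideal 0\<close> raises the index, and \<open>J\<close> is reached once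
  it contains \<open>Zpow i\<close>.\<close>

definition Zideal :: "nat \<Rightarrow> 'a set" where
  "Zideal i = two_sided_ideal hull (J \<union> Zpow i)"

lemma two_sided_ideal_Zideal: "two_sided_ideal (Zideal i)"
  unfolding Zideal_def by (rule two_sided_ideal_hull)

lemma subset_Zideal: "J \<subseteq> Zideal i" "Zpow i \<subseteq> Zideal i"
  unfolding Zideal_def using hull_subset[of "J \<union> Zpow i" two_sided_ideal] by auto

lemma Zideal_least:
  "two_sided_ideal K \<Longrightarrow> J \<subseteq> K \<Longrightarrow> Zpow i \<subseteq> K \<Longrightarrow> Zideal i \<subseteq> K"
  unfolding Zideal_def by (rule hull_minimal) auto

lemma two_sided_ideal_mulI:
  assumes "additive_subgroup K" "\<And>r x. x \<in> K \<Longrightarrow> r \<odot> x \<in> K" "\<And>r x. x \<in> K \<Longrightarrow> x \<odot> r \<in> K"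
  shows "two_sided_ideal K"
  using assms mul_cases by (auto simp: two_sided_ideal_iff)

text \<open>The critical products are \<open>w \<odot> (r \<odot> c)\<close> with \<open>w\<close>
  in \<open>Zpow i\<close> and \<open>c\<close> in \<open>Z\<close>. Since
  \<open>r \<odot> c\<close> lies in \<open>I\<close>, it commutes with \<open>w\<close> modulo
  \<open>J\<close>, which leaves \<open>r \<odot> (c \<odot> w)\<close>, a multiple of an element of
  \<open>Zpow (Suc i)\<close>.\<close>

lemma Zideal_mul:
  assumes "x \<in> Zideal i" "y \<in> Zideal 0"
  shows "x \<odot> y \<in> Zideal (Suc i)"
proof -
  let ?K = "Zideal (Suc i)"
  have K: "two_sided_ideal ?K" and K_sub: "additive_subgroup ?K"
    using two_sided_ideal_Zideal[of "Suc i"] by (auto simp: two_sided_ideal_iff)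
  note K_mul = ideal_mul[OF K]
  have Zpow_mul: "w \<odot> u \<in> ?K" if w: "w \<in> Zpow i" and u: "u \<in> I" "u \<odot> w \<in> ?K" for w u
  proof -
    have "br w u + u \<odot> w \<in> ?K"
      using subset_Zideal Zpow_central(1)[OF w u(1)] u(2) by (intro additive_subgroup_add[OF K_sub]) auto
    then show ?thesis by (simp add: br_def)
  qed
  have x: "x \<odot> c \<in> ?K \<and> (\<forall>r. x \<odot> (r \<odot> c) \<in> ?K)" if c: "c \<in> Z" for c
  proof -
    \<comment> \<open>Quantifying over \<open>r\<close> makes \<open>?X\<close> closed under
      multiplication on the right, in the sense of \<open>mul\<close>. It is then an ideal, and
      testing \<open>J\<close> and \<open>Zpow i\<close> suffices.\<close>
    let ?X = "{x. x \<odot> c \<in> ?K \<and> (\<forall>r. x \<odot> (r \<odot> c) \<in> ?K)}"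
    have "two_sided_ideal ?X"
    proof (rule two_sided_ideal_mulI)
      show "additive_subgroup ?X"
        using K_sub by (auto simp: additive_subgroup_def mul_zero diff_mul)
      show "r \<odot> y \<in> ?X" if "y \<in> ?X" for r y
        using that by (simp add: mul_assoc K_mul)
      show "y \<odot> r \<in> ?X" if "y \<in> ?X" for r y
      proof -
        have "y \<odot> ((r \<odot> s) \<odot> c) \<in> ?K" for s
          using that by blast
        then show ?thesis
          using that by (simp add: mul_assoc)
      qed
    qed
    moreover have "J \<subseteq> ?X"
      using subset_Zideal(1)[of "Suc i"] by (auto intro!: K_mul(2))
    moreover have "Zpow i \<subseteq> ?X"
    proof
      fix w assume w: "w \<in> Zpow i"
      have cI: "c \<in> I" using c by (simp add: Z_def)
      have "c \<odot> w \<in> ?K"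
        using subset_Zideal(2)[of "Suc i"] c w by auto
      then show "w \<in> ?X"
        using Zpow_mul[OF w] cI by (simp add: mul_I mul_assoc K_mul)
    qed
    ultimately have "Zideal i \<subseteq> ?X"
      by (rule Zideal_least)
    then show ?thesis using assms(1) by blast
  qed
  \<comment> \<open>The same device for the second factor, where the quantifier gives closure on the
    left.\<close>
  let ?Y = "{y. x \<odot> y \<in> ?K \<and> (\<forall>r. x \<odot> (r \<odot> y) \<in> ?K)}"
  have "two_sided_ideal ?Y"
  proof (rule two_sided_ideal_mulI)
    show "additive_subgroup ?Y"
      using K_sub by (auto simp: additive_subgroup_def mul_zero mul_diff)
    show "r \<odot> y \<in> ?Y" if "y \<in> ?Y" for r y
    proof -
      have "x \<odot> ((s \<odot> r) \<odot> y) \<in> ?K" for s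
        using that by blast
      then show ?thesis
        using that by (simp add: mul_assoc)
    qed
    show "y \<odot> r \<in> ?Y" if "y \<in> ?Y" for r y
    proof -
      have "(x \<odot> y) \<odot> r \<in> ?K" "(x \<odot> (s \<odot> y)) \<odot> r \<in> ?K" for s
        using that K_mul(2) by blast+
      then show ?thesis
        by (simp add: mul_assoc)
    qed
  qed
  moreover have "J \<subseteq> ?Y"
    using subset_Zideal(1)[of "Suc i"] by (auto intro!: K_mul(1))
  moreover have "Zpow 0 \<subseteq> ?Y"
    using x by auto
  ultimately have "Zideal 0 \<subseteq> ?Y"
    by (rule Zideal_least)
  then show ?thesis using assms(2) by blast
qed

lemma Zideal_subset: "Zideal i \<subseteq> Zideal 0"
proof (rule Zideal_least)
  show "Zpow i \<subseteq> Zideal 0"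
    using subset_Zideal(2)[of 0] by (induction i) (auto intro!: ideal_mul two_sided_ideal_Zideal)
qed (simp_all add: two_sided_ideal_Zideal subset_Zideal)

lemma assoc_nilpotent_Zideal:
  assumes "assoc_nilpotent J" "Zpow i \<subseteq> J"
  shows "assoc_nilpotent (Zideal 0)"
proof -
  have "Zideal i = J"
    using Zideal_least[OF J_ideal _ assms(2)] subset_Zideal by blast
  then have nilp: "assoc_nilpotent (Zideal i)"
    using assms(1) by simp
  \<comment> \<open>Downward from \<open>Zideal i = J\<close>: as \<open>Zideal j\<close> lies in
    \<open>Zideal 0\<close>, its square lies in \<open>Zideal (Suc j)\<close>.\<close>
  have "assoc_nilpotent (Zideal j)" if "j \<le> i" for j
    using that
  proof (induction rule: inc_induct)
    case (step j)
    have "x * y \<in> Zideal (Suc j)" if "x \<in> Zideal j" "y \<in> Zideal j" for x y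
      using mul_cases Zideal_mul[of x j y] Zideal_mul[of y j x] that Zideal_subset by auto
    then show ?case
      using assoc_nilpotent_square two_sided_ideal_Zideal step by blast
  qed (rule nilp)
  then show ?thesis by simp
qed

section \<open>Descent along the lower central series of \<open>I\<close>\<close>

lemma lower_central_subset: "lie_lower_central I (Suc i) \<subseteq> I"
proof (induction i)
  case (Suc i)
  have "br x y \<in> I" if "x \<in> I" "y \<in> I" for x y
    unfolding br_def using that by (intro additive_subgroup_diff I_subgroup mul_I)
  then have "commutator x y \<in> I" if "x \<in> I" "y \<in> I" for x y
    using that br_mem_iff[OF I_subgroup] by blast
  then show ?case
    unfolding lie_lower_central.simps subgroup_bracket_def
    using Suc by (intro group_closure_least I_subgroup) blast
qed simp

text \<open>Brackets of this term with \<open>I\<close> fall into \<open>J\<close>, which is what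
  membership in \<open>Z\<close> demands. Passing from \<open>J\<close> to \<open>Zideal 0\<close>
  thus gains one term of the series.\<close>

lemma lower_central_subset_Zideal:
  assumes "lie_lower_central I (Suc (Suc i)) \<subseteq> J"
  shows "lie_lower_central I (Suc i) \<subseteq> Zideal 0"
proof -
  have "commutator x y \<in> J" if "x \<in> lie_lower_central I (Suc i)" "y \<in> I" for x y
    using assms that by (auto simp: subgroup_bracket_def intro!: group_closure.base)
  then have "lie_lower_central I (Suc i) \<subseteq> Z"
    using lower_central_subset br_mem_iff[OF J_subgroup] by (auto simp: Z_def)
  then show ?thesis
    using subset_Zideal(2)[of 0] by simp
qed

lemma lower_central_le_subset:
  assumes "lie_lower_central I (Suc k) \<subseteq> J" "k \<le> i"
  shows "lie_lower_central I (Suc i) \<subseteq> J"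
  using assms(2)
proof (induction rule: dec_induct)
  case (step i)
  then have "commutator x y \<in> J" if "x \<in> lie_lower_central I (Suc i)" for x y
    using that J_ideal by (auto simp: commutator_def two_sided_ideal_iff intro!: additive_subgroup_diff)
  then show ?case
    unfolding lie_lower_central.simps subgroup_bracket_def
    by (intro group_closure_least J_subgroup) blast
qed (rule assms(1))

end

text \<open>\<open>J\<close> varies in the induction: each step replaces it by
  \<open>Zideal 0\<close> and lowers \<open>k\<close> by one. At \<open>k = 0\<close> the term in
  question is \<open>I\<close> itself, so \<open>J\<close> is the ideal sought.\<close>

lemma sided_ideal_subset_nilpotent_ideal:
  assumes "sided_ideal mul I J" "assoc_nilpotent J"
    and "I \<subseteq> lie_lower_central_ideal UNIV (Suc i)" "lie_lower_central I (Suc k) \<subseteq> J" "k \<le> i"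
  shows "\<exists>S. two_sided_ideal S \<and> assoc_nilpotent S \<and> I \<subseteq> S"
  using assms
proof (induction k arbitrary: J)
  case 0
  then show ?case
    by (intro exI[of _ J]) (simp add: sided_ideal_def)
next
  case (Suc k)
  interpret sided_ideal mul I J by fact
  have "lie_lower_central I (Suc i) \<subseteq> J"
    using Suc.prems(4,5) by (rule lower_central_le_subset)
  then have "assoc_nilpotent (Zideal 0)"
    using Suc.prems(2,3) by (intro assoc_nilpotent_Zideal[of "Suc i"] Zpow_subset_J)
  moreover have "sided_ideal mul I (Zideal 0)"
    by unfold_locales (simp_all add: mul_cases I_subgroup mul_I two_sided_ideal_Zideal)
  ultimately show ?case
    using Suc.prems by (intro Suc.IH[of "Zideal 0"] lower_central_subset_Zideal) simp_all
qed

theorem theorem2: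
  fixes I :: "'a::ring set" and n :: nat
  assumes "n \<ge> 1"
    and "left_ideal I \<or> right_ideal I"
    and "lie_nilpotent I"
    and "I \<subseteq> lie_lower_central_ideal (UNIV :: 'a set) n"
    and "lie_nilpotency_class I < n"
  shows "\<exists>S :: 'a set. two_sided_ideal S \<and> assoc_nilpotent S \<and> I \<subseteq> S"
proof -
  let ?k = "lie_nilpotency_class I"
  obtain i where n: "n = Suc i"
    using assms(1) by (cases n) auto
  have "lie_lower_central I (?k + 1) = {0}"
    using assms(3) unfolding lie_nilpotent_def lie_nilpotency_class_def by (rule LeastI_ex)
  then have k: "lie_lower_central I (Suc ?k) \<subseteq> {0}"
    by simp
  \<comment> \<open>The induction starts from the zero ideal, with \<open>k\<close> the class of
    \<open>I\<close>.\<close>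
  have nilp: "assoc_nilpotent {0 :: 'a}"
    unfolding assoc_nilpotent_def by (intro exI[of _ 1]) simp
  have "\<exists>mul :: 'a \<Rightarrow> 'a \<Rightarrow> 'a. sided_ideal mul I {0}"
    using assms(2)
  proof
    assume "left_ideal I"
    then have "sided_ideal (*) I {0}"
      by (simp add: sided_ideal_def left_ideal_def two_sided_ideal_iff additive_subgroup_def)
    then show ?thesis by blast
  next
    assume "right_ideal I"
    then have "sided_ideal (\<lambda>x y. y * x) I {0}"
      by (simp add: sided_ideal_def right_ideal_def two_sided_ideal_iff additive_subgroup_def)
    then show ?thesis by blast
  qed
  then show ?thesis
    using sided_ideal_subset_nilpotent_ideal[OF _ nilp assms(4)[unfolded n] k] assms(5) n by auto
qed

end
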